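(* Let $n\ge 1$, let $|\cdot|$ be the standard Euclidean norm on $\mathbb R^n$, and put $T(p)=|p|^2/2$ for $p\in\mathbb R^n$. Let $V:\mathbb R^n\to\mathbb R$ be proper, even, and $2$-homogeneous, and let $V$ be convex or continuously differentiable. Then for every $E>0$ the set $$X=\{(p,q)\in\mathbb R^{n}\times\mathbb R^n \mid T(p)+V(q)\le E\}$$ satisfies Viterbo's inequality $$\operatorname{vol} X\ \ge\ \frac{c_{EHZ}(X)^n}{n!}.$$
   Context: $\mathbb R^{2n}$ has coordinates $(p,q)=(p_1,\dots,p_n,q_1,\dots,q_n)$ and symplectic form $\omega=\sum_{i=1}^n dp_i\wedge dq_i$; $\operatorname{vol}$ is Lebesgue measure on $\mathbb R^{2n}$. A function $V$ is proper if $V(q)\to+\infty$ as $|q|\to\infty$; it is even and $2$-homogeneous if $V(tq)=t^2V(q)$ for all $t\in\mathbb R$ and $q\in\mathbb R^n$. If $\partial X$ is a ($C^1$) smooth hypersurface, a closed characteristic on $\partial X$ is a closed curve $\gamma$ in $\partial X$ whose velocity $\dot\gamma$ is nonzero and always lies in the one-dimensional kernel of the restriction of $\omega$ to the tangent space $T\partial X$, oriented in the direction of the Hamiltonian flow $\dot q_i=\partial H/\partial p_i$, $\dot p_i=-\partial H/\partial q_i$ of a function $H$ having $X$ as a sublevel set with regular boundary level. Its action is $\int_\gamma\sum_{i=1}^n p_i\,dq_i$. The quantity $c_{EHZ}(X)$ is the smallest action (the infimum of the actions) of a closed characteristic on $\partial X$ when $\partial X$ is smooth. For convex bodies this is the Ekeland--Hofer--Zehnder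 capacity, and it is extended to non-smooth convex bodies by continuity in the Hausdorff metric. *)

theory Defs
  imports "HOL-Analysis.Analysis"
begin

text \<open>
  The phase space is \<open>real^'n \<times> real^'n\<close>, a point being \<open>z = (p, q)\<close>; so \<open>fst z\<close> is the momentum and
  \<open>snd z\<close> the position, and \<open>n = CARD('n)\<close>.
\<close>

type_synonym 'n phase = "(real^'n) \<times> (real^'n)"

definition C1_with_gradient :: "('a::real_inner \<Rightarrow> real) \<Rightarrow> ('a \<Rightarrow> 'a) \<Rightarrow> bool" where
  "C1_with_gradient f g \<longleftrightarrow> (\<forall>x. GDERIV f x :> g x) \<and> continuous_on UNIV g"

definition C1_function :: "('a::real_inner \<Rightarrow> real) \<Rightarrow> bool" where
  "C1_function f \<longleftrightarrow> (\<exists>g. C1_with_gradient f g)"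

definition even_2_homogeneous :: "('a::real_vector \<Rightarrow> real) \<Rightarrow> bool" where
  "even_2_homogeneous V \<longleftrightarrow> (\<forall>t q. V (t *\<^sub>R q) = t\<^sup>2 * V q)"

definition proper_potential :: "('a::real_normed_vector \<Rightarrow> real) \<Rightarrow> bool" where
  "proper_potential V \<longleftrightarrow> filterlim V at_top at_infinity"


definition symplectic_form :: "'n::finite phase \<Rightarrow> 'n phase \<Rightarrow> real" where
  "symplectic_form u v = (\<Sum>i\<in>UNIV. fst u $ i * snd v $ i - fst v $ i * snd u $ i)"

text \<open>
  For a gradient \<open>a = (\<partial>H/\<partial>p, \<partial>H/\<partial>q)\<close>, the Hamiltonian vector \<open>(p', q') = (-\<partial>H/\<partial>q, \<partial>H/\<partial>p)\<close>.
\<close>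

definition hamiltonian_vector :: "'n::finite phase \<Rightarrow> 'n phase" where
  "hamiltonian_vector a = (- snd a, fst a)"

text \<open>
  \<open>X\<close> is the sublevel set \<open>{H \<le> c}\<close> of the \<open>C\<^sup>1\<close> function \<open>H\<close> with gradient \<open>g\<close>, and \<open>c\<close> is a
  regular value. Then \<open>frontier X = {H = c}\<close> is a \<open>C\<^sup>1\<close> hypersurface whose tangent space at \<open>z\<close> is
  the orthogonal complement of \<open>g z\<close>. Another choice of \<open>H\<close> changes \<open>g\<close> on the boundary only by a
  positive factor, so the notions below do not depend on that choice.
\<close>

definition regular_sublevel ::
    "('n::finite phase \<Rightarrow> real) \<Rightarrow> ('n phase \<Rightarrow> 'n phase) \<Rightarrow> real \<Rightarrow> 'n phase set \<Rightarrow> bool" where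
  "regular_sublevel H g c X \<longleftrightarrow>
     C1_with_gradient H g \<and> X = {z. H z \<le> c} \<and> (\<forall>z. H z = c \<longrightarrow> g z \<noteq> 0)"

definition smooth_boundary :: "'n::finite phase set \<Rightarrow> bool" where
  "smooth_boundary X \<longleftrightarrow> (\<exists>H g c. regular_sublevel H g c X)"

definition characteristic_kernel :: "'n::finite phase \<Rightarrow> 'n phase set" where
  "characteristic_kernel a =
     {v. v \<bullet> a = 0 \<and> (\<forall>w. w \<bullet> a = 0 \<longrightarrow> symplectic_form v w = 0)}"

text \<open>
  A closed characteristic is parametrized by \<open>[0,1]\<close>, with one-sided derivatives at the end points.
  The velocities at 0 and 1 are automatically positive multiples of each other, so that the closed
  curve is \<open>C\<^sup>1\<close> up to reparametrization. The last conjunct is the orientation: the kernel is a line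
  spanned by the Hamiltonian vector.
\<close>

definition closed_characteristic :: "'n::finite phase set \<Rightarrow> (real \<Rightarrow> 'n phase) \<Rightarrow> bool" where
  "closed_characteristic X \<gamma> \<longleftrightarrow>
     (\<exists>H g c \<gamma>'. regular_sublevel H g c X \<and>
        continuous_on {0..1} \<gamma>' \<and> \<gamma> 0 = \<gamma> 1 \<and>
        (\<forall>t\<in>{0..1}.
           (\<gamma> has_vector_derivative \<gamma>' t) (at t within {0..1}) \<and>
           \<gamma> t \<in> frontier X \<and>
           \<gamma>' t \<noteq> 0 \<and>
           \<gamma>' t \<in> characteristic_kernel (g (\<gamma> t)) \<and>
           \<gamma>' t \<bullet> hamiltonian_vector (g (\<gamma> t)) > 0))"

definition action :: "(real \<Rightarrow> 'n::finite phase) \<Rightarrow> real" where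
  "action \<gamma> = integral {0..1}
     (\<lambda>t. \<Sum>i\<in>UNIV. fst (\<gamma> t) $ i * snd (vector_derivative \<gamma> (at t within {0..1})) $ i)"

definition min_action :: "'n::finite phase set \<Rightarrow> real" where
  "min_action X = Inf {action \<gamma> | \<gamma>. closed_characteristic X \<gamma>}"


definition convex_body :: "'a::euclidean_space set \<Rightarrow> bool" where
  "convex_body X \<longleftrightarrow> convex X \<and> compact X \<and> interior X \<noteq> {}"

definition hausdorff_distance :: "'a::metric_space set \<Rightarrow> 'a set \<Rightarrow> real" where
  "hausdorff_distance A B = max (SUP x\<in>A. infdist x B) (SUP y\<in>B. infdist y A)"

text \<open>The filter of smooth convex bodies \<open>Y\<close> tending to \<open>X\<close> in the Hausdorff metric.\<close>

definition smooth_bodies_near :: "'n::finite phase set \<Rightarrow> 'n phase set filter" where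
  "smooth_bodies_near X =
     inf (filtercomap (\<lambda>Y. hausdorff_distance Y X) (nhds 0))
         (principal {Y. convex_body Y \<and> smooth_boundary Y})"

text \<open>
  Extension of the smallest action to non-smooth convex bodies by continuity. The final 0 is only a
  conventional value outside the domain of definition (\<open>X\<close> neither smooth nor a convex body, or no
  limit): by the continuity of the Ekeland--Hofer--Zehnder capacity the limit exists for every
  convex body.
\<close>

definition c_EHZ :: "'n::finite phase set \<Rightarrow> real" where
  "c_EHZ X =
     (if smooth_boundary X then min_action X
      else if convex_body X \<and> (\<exists>c. (min_action \<longlongrightarrow> c) (smooth_bodies_near X))
      then Lim (smooth_bodies_near X) min_action
      else 0)"

end

theory Submission
  imports Defs
begin

text \<open>
  Let \<open>M\<close> be the maximum of \<open>V\<close> on the unit sphere, attained at \<open>q0\<close>. By homogeneity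
  \<open>V q \<le> M * |q|\<^sup>2\<close> with equality on the line through \<open>q0\<close>, so \<open>X\<close> contains the ellipsoid
  \<open>{|p|\<^sup>2 / 2 + M * |q|\<^sup>2 \<le> E}\<close>, and the two boundaries share the ellipse that the ellipsoid cuts
  from the plane \<open>{(a q0, b q0)}\<close>. Where the boundary of \<open>X\<close> is smooth it is tangent to the ellipsoid
  along this ellipse, hence has the same characteristic direction there. The ellipse is a closed
  characteristic of the ellipsoid (a harmonic oscillation along \<open>q0\<close>), so it is one of \<open>X\<close>, and its
  action is its area \<open>\<pi> E sqrt (2 / M)\<close>. On the other hand the ellipsoid, which is the image of the
  unit ball under dilations of \<open>p\<close> and \<open>q\<close>, has volume exactly \<open>(\<pi> E sqrt (2 / M))\<^sup>n / n!\<close>.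
  Thus both sides of the inequality are compared with the same number.

  The upper bound on the infimum of actions needs the actions to be bounded below; they are
  nonnegative because a momentum fibre of \<open>X\<close> is star-shaped about \<open>p = 0\<close>
  (\<open>action_nonneg\<close>, \<open>planar_orbit\<close>, \<open>min_action_bounds\<close>, \<open>measure_energy_sublevel_ge\<close>).
  If \<open>V\<close> is continuously differentiable, Euler's identity shows that the boundary of \<open>X\<close> is smooth.

  If \<open>V\<close> is only convex and \<open>X\<close> is not smooth, the capacity is a limit along smooth convex bodies. Such
  bodies of the same mechanical type are obtained by replacing \<open>V\<close> with its Moreau envelope
  \<open>inf\<^sub>y V y + k |q - y|\<^sup>2\<close>, which is again convex and homogeneous, is always
  continuously differentiable, and lies between \<open>k / (k + M) * V\<close> and \<open>V\<close>. As \<open>k\<close> tends to infinity,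
  the bodies tend to \<open>X\<close> and the bounds for their least actions tend to the bound above
  (\<open>moreau_envelope_C1\<close>, \<open>moreau_envelope_ge\<close>, \<open>smooth_approximation_near\<close>, \<open>c_EHZ_bounds\<close>).
\<close>

section \<open>Gradients and characteristics of sublevel sets\<close>

lemma DERIV_along_line:
  assumes "GDERIV H z :> a"
  shows "DERIV (\<lambda>t. H (z + t *\<^sub>R w)) 0 :> w \<bullet> a"
proof -
  have line: "((\<lambda>t::real. z + t *\<^sub>R w) has_derivative (\<lambda>t. t *\<^sub>R w)) (at 0)"
    by (auto intro!: derivative_eq_intros)
  have "(H has_derivative (\<lambda>h. h \<bullet> a)) (at (z + 0 *\<^sub>R w))"
    using assms by (simp add: gderiv_def)
  from has_derivative_compose[OF line this]
  show ?thesis by (simp add: has_field_derivative_def mult_commute_abs)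
qed

lemma gradient_inner_nonpos:
  fixes H :: "'a::real_inner \<Rightarrow> real"
  assumes grad: "GDERIV H z :> a" and "\<delta> > 0"
    and le: "\<And>t. 0 < t \<Longrightarrow> t < \<delta> \<Longrightarrow> H (z + t *\<^sub>R w) \<le> H z"
  shows "w \<bullet> a \<le> 0"
proof (rule ccontr)
  assume "\<not> w \<bullet> a \<le> 0"
  from DERIV_pos_inc_right[OF DERIV_along_line[OF grad, of w]] \<open>\<not> w \<bullet> a \<le> 0\<close> obtain d
    where "d > 0" and d: "\<And>h. 0 < h \<Longrightarrow> h < d \<Longrightarrow> H z < H (z + h *\<^sub>R w)" by auto
  define t where "t = min d \<delta> / 2"
  have "0 < t" "t < d" "t < \<delta>" using \<open>d > 0\<close> \<open>\<delta> > 0\<close> by (auto simp: t_def)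
  then show False using d[of t] le[of t] by simp
qed

lemma scaleR_if_orthogonal_complement_le:
  fixes a b :: "'a::real_inner"
  assumes "\<And>w. w \<bullet> a = 0 \<Longrightarrow> w \<bullet> b = 0"
  shows "\<exists>s. b = s *\<^sub>R a"
proof (cases "a = 0")
  case True
  with assms[of b] show ?thesis by simp
next
  case False
  define s where "s = (b \<bullet> a) / (a \<bullet> a)"
  define w where "w = b - s *\<^sub>R a"
  have "w \<bullet> a = 0" using False by (simp add: w_def s_def inner_diff_left)
  with assms[OF this] have "w \<bullet> w = 0" by (simp add: w_def inner_diff_right)
  then show ?thesis by (auto simp: w_def)
qed

text \<open>
  Two hypersurfaces that touch have parallel normals. The proof perturbs a vector \<open>w\<close> orthogonal
  to \<open>k\<close> into the open half space by a small multiple of \<open>k\<close>, which forces \<open>w \<bullet> a \<le> 0\<close>.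
\<close>

lemma positive_multiple_if_halfspace_le:
  fixes a k :: "'a::real_inner"
  assumes "a \<noteq> 0" "k \<noteq> 0" and half: "\<And>w. w \<bullet> k < 0 \<Longrightarrow> w \<bullet> a \<le> 0"
  shows "\<exists>\<mu>>0. a = \<mu> *\<^sub>R k"
proof -
  have kk: "k \<bullet> k > 0" using \<open>k \<noteq> 0\<close> by simp
  have tangent: "w \<bullet> a \<le> 0" if w: "w \<bullet> k = 0" for w
  proof (rule ccontr)
    assume pos: "\<not> w \<bullet> a \<le> 0"
    define \<eta> where "\<eta> = (w \<bullet> a) / (2 * (\<bar>k \<bullet> a\<bar> + 1))"
    have "\<eta> > 0" using pos by (simp add: \<eta>_def)
    then have "(w - \<eta> *\<^sub>R k) \<bullet> k < 0" using w kk by (simp add: inner_diff_left)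
    from half[OF this] have "w \<bullet> a \<le> \<eta> * (k \<bullet> a)" by (simp add: inner_diff_left)
    also have "\<dots> \<le> \<eta> * (\<bar>k \<bullet> a\<bar> + 1)" using \<open>\<eta> > 0\<close> by (intro mult_left_mono) auto
    also have "\<dots> = (w \<bullet> a) / 2" by (simp add: \<eta>_def add_pos_nonneg field_simps)
    finally show False using pos by simp
  qed
  have "w \<bullet> a = 0" if "w \<bullet> k = 0" for w
    using tangent[of w] tangent[of "- w"] that by simp
  then obtain s where s: "a = s *\<^sub>R k" using scaleR_if_orthogonal_complement_le[of k a] by blast
  have "- (s * (k \<bullet> k)) \<le> 0" using half[of "- k"] kk by (simp add: s)
  then have "s \<ge> 0" using kk by (simp add: zero_le_mult_iff)
  moreover have "s \<noteq> 0" using s \<open>a \<noteq> 0\<close> by auto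
  ultimately show ?thesis using s by (intro exI[of _ s]) auto
qed

lemma C1_with_gradient_imp_continuous:
  "C1_with_gradient H g \<Longrightarrow> continuous_on UNIV H"
  by (metis C1_with_gradient_def continuous_at_imp_continuous_on gderiv_def has_derivative_continuous)

lemma regular_sublevel_frontier:
  assumes "regular_sublevel H g c X" "z \<in> frontier X"
  shows "H z = c"
proof -
  have X: "X = {z. H z \<le> c}" and cont: "continuous_on UNIV H"
    using assms(1) C1_with_gradient_imp_continuous by (auto simp: regular_sublevel_def)
  have "closed X" unfolding X using cont by (intro closed_Collect_le) auto
  then have "z \<in> X" using assms(2) by (auto simp: frontier_def)
  moreover have "open {z. H z < c}" using cont by (intro open_Collect_less) auto
  then have "{z. H z < c} \<subseteq> interior X" by (intro interior_maximal) (auto simp: X)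
  ultimately show ?thesis using assms(2) unfolding X frontier_def by force
qed

lemma symplectic_form_inner:
  "symplectic_form u v = v \<bullet> (- snd u, fst u)"
  by (simp add: symplectic_form_def inner_vec_def inner_prod_def sum_subtractf sum_negf mult.commute)

lemma characteristic_kernel_positive_multiple:
  assumes "v \<in> characteristic_kernel a" "v \<bullet> hamiltonian_vector a > 0"
  shows "\<exists>r>0. v = r *\<^sub>R hamiltonian_vector a"
proof -
  have "w \<bullet> (- snd v, fst v) = 0" if "w \<bullet> a = 0" for w
    using assms(1) that unfolding characteristic_kernel_def symplectic_form_inner by blast
  then obtain s where s: "(- snd v, fst v) = s *\<^sub>R a"
    using scaleR_if_orthogonal_complement_le[of a "(- snd v, fst v)"] by blast
  then have v: "v = (- s) *\<^sub>R hamiltonian_vector a"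
    by (cases v; cases a) (auto simp: hamiltonian_vector_def, metis minus_minus)
  have "(- s) * (hamiltonian_vector a \<bullet> hamiltonian_vector a) > 0"
    using assms(2) by (subst (asm) v) simp
  moreover have "\<not> hamiltonian_vector a \<bullet> hamiltonian_vector a < 0" by (simp add: not_less)
  ultimately have "- s > 0" unfolding zero_less_mult_iff by blast
  then show ?thesis using v by blast
qed

lemma hamiltonian_vector_in_characteristic_kernel:
  "r *\<^sub>R hamiltonian_vector a \<in> characteristic_kernel a"
proof -
  have "symplectic_form (r *\<^sub>R hamiltonian_vector a) w = - r * (w \<bullet> a)" for w
    by (cases w; cases a) (simp add: symplectic_form_inner hamiltonian_vector_def algebra_simps)
  then show ?thesis
    by (auto simp: characteristic_kernel_def hamiltonian_vector_def inner_prod_def inner_commute)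
qed

text \<open>
  The kinetic term is built in, since the approximation argument varies only the potential.
\<close>

definition energy_sublevel :: "(real^'n \<Rightarrow> real) \<Rightarrow> real \<Rightarrow> 'n::finite phase set" where
  "energy_sublevel V E = {z. (norm (fst z))\<^sup>2 / 2 + V (snd z) \<le> E}"

lemma action_eq:
  assumes "\<And>t. t \<in> {0..1} \<Longrightarrow> (\<gamma> has_vector_derivative \<gamma>' t) (at t within {0..1})"
  shows "action \<gamma> = integral {0..1} (\<lambda>t. fst (\<gamma> t) \<bullet> snd (\<gamma>' t))"
  unfolding action_def
proof (rule integral_cong)
  fix t :: real assume t: "t \<in> {0..1}"
  have "vector_derivative \<gamma> (at t within {0..1}) = \<gamma>' t"
    using vector_derivative_within_cbox[of 0 1 t] t assms[OF t] by auto
  then show "(\<Sum>i\<in>UNIV. fst (\<gamma> t) $ i * snd (vector_derivative \<gamma> (at t within {0..1})) $ i) =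
      fst (\<gamma> t) \<bullet> snd (\<gamma>' t)" by (simp add: inner_vec_def)
qed

text \<open>
  Along a characteristic the velocity is a positive multiple of the Hamiltonian vector, so the
  integrand \<open>p \<bullet> q'\<close> has the sign of \<open>p \<bullet> \<partial>H/\<partial>p\<close>. This is the derivative of \<open>H\<close> in the direction
  \<open>(p, 0)\<close>, and it cannot be negative at a boundary point when scaling \<open>p\<close> down stays inside \<open>X\<close>.
\<close>

lemma action_nonneg:
  fixes X :: "'n::finite phase set"
  assumes char: "closed_characteristic X \<gamma>"
    and shrink: "\<And>p q s. (p, q) \<in> X \<Longrightarrow> 0 \<le> s \<Longrightarrow> s \<le> 1 \<Longrightarrow> (s *\<^sub>R p, q) \<in> X"
  shows "action \<gamma> \<ge> 0"
proof -
  obtain H g c \<gamma>' where reg: "regular_sublevel H g c X"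
    and deriv: "\<And>t. t \<in> {0..1} \<Longrightarrow> (\<gamma> has_vector_derivative \<gamma>' t) (at t within {0..1})"
    and front: "\<And>t. t \<in> {0..1} \<Longrightarrow> \<gamma> t \<in> frontier X"
    and ker: "\<And>t. t \<in> {0..1} \<Longrightarrow> \<gamma>' t \<in> characteristic_kernel (g (\<gamma> t))"
    and ori: "\<And>t. t \<in> {0..1} \<Longrightarrow> \<gamma>' t \<bullet> hamiltonian_vector (g (\<gamma> t)) > 0"
    using char unfolding closed_characteristic_def by metis
  have pos: "fst (\<gamma> t) \<bullet> snd (\<gamma>' t) \<ge> 0" if t: "t \<in> {0..1}" for t
  proof -
    obtain p q where z: "\<gamma> t = (p, q)" by (cases "\<gamma> t")
    obtain r where r: "r > 0" "\<gamma>' t = r *\<^sub>R hamiltonian_vector (g (\<gamma> t))"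
      using characteristic_kernel_positive_multiple[OF ker[OF t] ori[OF t]] by blast
    have Hz: "H (p, q) = c" using regular_sublevel_frontier[OF reg front[OF t]] z by simp
    have X: "X = {z. H z \<le> c}" and grad: "GDERIV H (p, q) :> g (p, q)"
      using reg by (auto simp: regular_sublevel_def C1_with_gradient_def)
    have "(- p, 0) \<bullet> g (p, q) \<le> 0"
    proof (rule gradient_inner_nonpos[OF grad])
      fix s :: real assume "0 < s" "s < 1"
      then have "((1 - s) *\<^sub>R p, q) \<in> X" using Hz by (intro shrink) (auto simp: X)
      then show "H ((p, q) + s *\<^sub>R (- p, 0)) \<le> H (p, q)"
        by (simp add: X Hz scaleR_left_diff_distrib)
    qed simp
    then show ?thesis using r z by (simp add: hamiltonian_vector_def inner_prod_def)
  qed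
  have "integral {0..1} (\<lambda>t. fst (\<gamma> t) \<bullet> snd (\<gamma>' t)) \<ge> 0"
  proof (cases "(\<lambda>t. fst (\<gamma> t) \<bullet> snd (\<gamma>' t)) integrable_on {0..1}")
    case True
    then show ?thesis using pos by (intro integral_nonneg) auto
  qed (simp add: not_integrable_integral)
  then show ?thesis using action_eq[of \<gamma> \<gamma>'] deriv by simp
qed

section \<open>A closed characteristic in a plane\<close>

lemma even_2_homogeneousD: "even_2_homogeneous V \<Longrightarrow> V (t *\<^sub>R q) = t\<^sup>2 * V q"
  by (simp add: even_2_homogeneous_def)

lemma even_2_homogeneous_zero: "even_2_homogeneous V \<Longrightarrow> V 0 = 0"
  using even_2_homogeneousD[of V 0 0] by simp

text \<open>
  The total energy is 2-homogeneous and positive at \<open>z\<close>, so the radial push \<open>(1 + s) z\<close> leaves \<open>X\<close>.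
\<close>

lemma energy_sublevel_frontier:
  fixes V :: "real^'n::finite \<Rightarrow> real"
  assumes hom: "even_2_homogeneous V" and "E > 0"
    and z: "(norm (fst z))\<^sup>2 / 2 + V (snd z) = E"
  shows "z \<in> frontier (energy_sublevel V E)"
proof -
  have "z \<notin> interior (energy_sublevel V E)"
  proof
    assume "z \<in> interior (energy_sublevel V E)"
    then obtain e where "e > 0" and e: "ball z e \<subseteq> energy_sublevel V E"
      by (auto simp: mem_interior)
    define s where "s = e / (2 * (norm z + 1))"
    have s: "s > 0" using \<open>e > 0\<close> by (simp add: s_def add_nonneg_pos)
    have "s * norm z < e"
    proof -
      have "s * norm z \<le> s * (norm z + 1)" using s by simp
      also have "\<dots> = e / 2"
      proof -
        define r where "r = norm z + 1"
        have "r > 0" using norm_ge_zero[of z] unfolding r_def by linarith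
        then show ?thesis unfolding s_def r_def[symmetric] by simp
      qed
      finally show ?thesis using \<open>e > 0\<close> by simp
    qed
    then have "(1 + s) *\<^sub>R z \<in> ball z e"
      using s by (simp add: dist_norm algebra_simps)
    with e have "(1 + s) *\<^sub>R z \<in> energy_sublevel V E" by blast
    moreover have "(norm (fst ((1 + s) *\<^sub>R z)))\<^sup>2 / 2 + V (snd ((1 + s) *\<^sub>R z)) = (1 + s)\<^sup>2 * E"
      using s unfolding fst_scaleR snd_scaleR even_2_homogeneousD[OF hom] norm_scaleR power_mult_distrib
        z[symmetric] by (simp add: distrib_left)
    ultimately have "(1 + s)\<^sup>2 * E \<le> 1 * E" by (simp add: energy_sublevel_def)
    then have "(1 + s)\<^sup>2 \<le> 1" using \<open>E > 0\<close> by (simp only: mult_le_cancel_right_pos)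
    moreover have "(1 + s)\<^sup>2 > 1" using s by (intro one_less_power) auto
    ultimately show False by simp
  qed
  moreover have "z \<in> closure (energy_sublevel V E)"
    using z closure_subset by (fastforce simp: energy_sublevel_def)
  ultimately show ?thesis by (simp add: frontier_def)
qed

lemma power2_norm_add_scaleR:
  "(norm (a + t *\<^sub>R b))\<^sup>2 = (norm a)\<^sup>2 + 2 * t * (a \<bullet> b) + t\<^sup>2 * (norm b)\<^sup>2"
  unfolding power2_norm_eq_inner
  by (simp add: inner_add_left inner_add_right inner_commute power2_eq_square)

text \<open>
  The ellipsoid \<open>{K \<le> E}\<close>, \<open>K (p, q) = |p|\<^sup>2 / 2 + M |q|\<^sup>2\<close>, lies inside \<open>X\<close> and meets its boundary
  at \<open>z\<close>. Moving from \<open>z\<close> into the ellipsoid keeps \<open>H \<le> c\<close>, so the gradient of \<open>H\<close> points along the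
  gradient of \<open>K\<close>. Thus the shape of \<open>X\<close> alone fixes the direction of the gradient, whichever function
  \<open>H\<close> describes \<open>X\<close>.
\<close>

lemma touching_gradient:
  fixes V :: "real^'n::finite \<Rightarrow> real"
  assumes reg: "regular_sublevel H g c (energy_sublevel V E)"
    and bound: "\<And>q. V q \<le> M * (norm q)\<^sup>2" and "E > 0" and "M > 0"
    and front: "z \<in> frontier (energy_sublevel V E)"
    and z: "(norm (fst z))\<^sup>2 / 2 + M * (norm (snd z))\<^sup>2 = E"
  shows "\<exists>\<mu>>0. g z = \<mu> *\<^sub>R (fst z, (2 * M) *\<^sub>R snd z)"
proof (rule positive_multiple_if_halfspace_le)
  have Hz: "H z = c" by (rule regular_sublevel_frontier[OF reg front])
  show "g z \<noteq> 0" using reg Hz unfolding regular_sublevel_def by blast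
  show "(fst z, (2 * M) *\<^sub>R snd z) \<noteq> 0" using z \<open>E > 0\<close> \<open>M > 0\<close> by (auto simp: zero_prod_def)
  fix w :: "'n phase" assume w: "w \<bullet> (fst z, (2 * M) *\<^sub>R snd z) < 0"
  let ?K = "\<lambda>z::'n phase. (norm (fst z))\<^sup>2 / 2 + M * (norm (snd z))\<^sup>2"
  let ?d = "w \<bullet> (fst z, (2 * M) *\<^sub>R snd z)"
  have K: "?K w \<ge> 0" using \<open>M > 0\<close> by simp
  show "w \<bullet> g z \<le> 0"
  proof (rule gradient_inner_nonpos)
    show "GDERIV H z :> g z" using reg unfolding regular_sublevel_def C1_with_gradient_def by blast
    \<comment> \<open>\<open>K (z + t w) = E + t (d + t K w)\<close>, where \<open>d = w \<bullet> grad K z < 0\<close>; the added 1 avoids a division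
      by zero.\<close>
    show "- ?d / (?K w + 1) > 0" using w K by (intro divide_pos_pos) auto
    fix t assume t: "0 < t" "t < - ?d / (?K w + 1)"
    have K1: "?K w + 1 > 0" using K by linarith
    have "t * (?K w + 1) < - ?d" using t(2) unfolding pos_less_divide_eq[OF K1] .
    then have "?d + t * ?K w \<le> 0" using t by (simp add: algebra_simps)
    then have "t * (?d + t * ?K w) \<le> 0" using t by (simp add: mult_le_0_iff)
    moreover have "?K (z + t *\<^sub>R w) = ?K z + t * (?d + t * ?K w)"
      unfolding fst_add snd_add fst_scaleR snd_scaleR power2_norm_add_scaleR
      by (simp add: inner_prod_def inner_commute power2_eq_square[of t] algebra_simps
          add_divide_distrib)
    ultimately have "?K (z + t *\<^sub>R w) \<le> E" using z by simp
    then have "z + t *\<^sub>R w \<in> energy_sublevel V E"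
      using bound[of "snd (z + t *\<^sub>R w)"] by (auto simp: energy_sublevel_def)
    then show "H (z + t *\<^sub>R w) \<le> H z" using reg Hz by (simp add: regular_sublevel_def)
  qed
qed

lemma integral_cos_squared_2pi: "((\<lambda>t. (cos (2 * pi * t))\<^sup>2) has_integral 1/2) {0..1}"
proof -
  let ?F = "\<lambda>t. t / 2 + sin (4 * pi * t) / (8 * pi)"
  have "((\<lambda>t. (cos (2 * pi * t))\<^sup>2) has_integral (?F 1 - ?F 0)) {0..1}"
  proof (rule fundamental_theorem_of_calculus)
    fix t :: real
    have "cos (4 * pi * t) = 2 * (cos (2 * pi * t))\<^sup>2 - 1"
      using cos_double_cos[of "2 * pi * t"] by (simp add: mult.assoc)
    moreover have "(?F has_real_derivative 1 / 2 + cos (4 * pi * t) / 2) (at t within {0..1})"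
      by (auto intro!: derivative_eq_intros)
    ultimately show "(?F has_vector_derivative (cos (2 * pi * t))\<^sup>2) (at t within {0..1})"
      by (simp add: field_simps flip: has_real_derivative_iff_has_vector_derivative)
  qed simp
  moreover have "sin (4 * pi) = 0" using sin_npi[of 4] by simp
  ultimately show ?thesis by simp
qed

lemma sqrt_semiaxes_product:
  assumes "E > 0"
  shows "sqrt (2 * E) * sqrt (E / M) = E * sqrt (2 / M)"
proof -
  have "sqrt (2 * E) * sqrt (E / M) = sqrt (E\<^sup>2 * (2 / M))"
    unfolding real_sqrt_mult[symmetric] by (simp add: power2_eq_square)
  also have "\<dots> = E * sqrt (2 / M)" using assms by (subst real_sqrt_mult) simp
  finally show ?thesis .
qed

text \<open>
  The witness solves \<open>q'' = -2 M q\<close> on the line through \<open>q0\<close>, up to the speed of parametrization: an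
  ellipse with semi-axes \<open>sqrt (2 E)\<close> in momentum and \<open>sqrt (E / M)\<close> in position. At each of its points
  the normal of \<open>X\<close> is that of the inscribed ellipsoid, so the Hamiltonian direction of \<open>X\<close> stays in the plane.
\<close>

lemma planar_orbit:
  fixes V :: "real^'n::finite \<Rightarrow> real"
  assumes hom: "even_2_homogeneous V" and "E > 0" and reg: "regular_sublevel H g c (energy_sublevel V E)"
    and q0: "norm q0 = 1" "V q0 > 0" and max: "\<And>q. V q \<le> V q0 * (norm q)\<^sup>2"
  shows "\<exists>\<gamma>. closed_characteristic (energy_sublevel V E) \<gamma> \<and> action \<gamma> = pi * E * sqrt (2 / V q0)"
proof -
  define M where "M = V q0"
  define a where "a = sqrt (2 * E)"
  define b where "b = sqrt (E / M)"
  have "M > 0" "a > 0" "b > 0" using q0 \<open>E > 0\<close> by (auto simp: M_def a_def b_def)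
  have a2: "a\<^sup>2 = 2 * E" and b2: "b\<^sup>2 = E / M"
    using \<open>E > 0\<close> \<open>M > 0\<close> by (auto simp: a_def b_def)
  define \<gamma> :: "real \<Rightarrow> 'n phase" where
    "\<gamma> t = ((a * cos (2 * pi * t)) *\<^sub>R q0, (b * sin (2 * pi * t)) *\<^sub>R q0)" for t
  define \<gamma>' :: "real \<Rightarrow> 'n phase" where
    "\<gamma>' t = ((- (2 * pi * a * sin (2 * pi * t))) *\<^sub>R q0, (2 * pi * b * cos (2 * pi * t)) *\<^sub>R q0)" for t
  have deriv: "(\<gamma> has_vector_derivative \<gamma>' t) (at t within {0..1})" for t
  proof -
    have "((\<lambda>t. (a * cos (2 * pi * t)) *\<^sub>R q0) has_vector_derivative
        (- (2 * pi * a * sin (2 * pi * t))) *\<^sub>R q0) (at t within {0..1})"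
      by (rule has_vector_derivative_scaleR[where g="\<lambda>_. q0" and g'=0, simplified])
        (auto intro!: derivative_eq_intros)
    moreover have "((\<lambda>t. (b * sin (2 * pi * t)) *\<^sub>R q0) has_vector_derivative
        (2 * pi * b * cos (2 * pi * t)) *\<^sub>R q0) (at t within {0..1})"
      by (rule has_vector_derivative_scaleR[where g="\<lambda>_. q0" and g'=0, simplified])
        (auto intro!: derivative_eq_intros)
    ultimately show ?thesis unfolding \<gamma>_def[abs_def] \<gamma>'_def by (rule has_vector_derivative_Pair)
  qed
  have nq: "q0 \<bullet> q0 = 1" using q0 by (simp add: norm_eq_sqrt_inner)
  have level: "(norm (fst (\<gamma> t)))\<^sup>2 / 2 + M * (norm (snd (\<gamma> t)))\<^sup>2 = E" for t
  proof -
    have "(norm (fst (\<gamma> t)))\<^sup>2 / 2 + M * (norm (snd (\<gamma> t)))\<^sup>2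
        = a\<^sup>2 * (cos (2 * pi * t))\<^sup>2 / 2 + M * (b\<^sup>2 * (sin (2 * pi * t))\<^sup>2)"
      by (simp add: \<gamma>_def q0 power_mult_distrib)
    also have "\<dots> = E * ((sin (2 * pi * t))\<^sup>2 + (cos (2 * pi * t))\<^sup>2)"
      unfolding a2 b2 distrib_left using \<open>M > 0\<close> by simp
    finally show ?thesis by simp
  qed
  have "V (snd (\<gamma> t)) = M * (norm (snd (\<gamma> t)))\<^sup>2" for t
    by (simp add: \<gamma>_def even_2_homogeneousD[OF hom] q0 M_def power_mult_distrib)
  then have front: "\<gamma> t \<in> frontier (energy_sublevel V E)" for t
    using level[of t] by (intro energy_sublevel_frontier[OF hom \<open>E > 0\<close>]) simp
  have velocity: "\<gamma>' t = (2 * pi * b / a) *\<^sub>R hamiltonian_vector (fst (\<gamma> t), (2 * M) *\<^sub>R snd (\<gamma> t))" for t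
  proof -
    have "b * b * M * 2 = a * a"
      using a2 b2 \<open>M > 0\<close> by (simp add: power2_eq_square)
    then show ?thesis using \<open>a > 0\<close>
      by (simp add: \<gamma>_def \<gamma>'_def hamiltonian_vector_def) (simp add: field_simps)
  qed
  have nonzero: "hamiltonian_vector (fst (\<gamma> t), (2 * M) *\<^sub>R snd (\<gamma> t)) \<noteq> 0" for t
    using level[of t] \<open>E > 0\<close> \<open>M > 0\<close> by (auto simp: hamiltonian_vector_def zero_prod_def)
  have "closed_characteristic (energy_sublevel V E) \<gamma>"
    unfolding closed_characteristic_def
  proof (intro exI conjI ballI)
    show "regular_sublevel H g c (energy_sublevel V E)" by (rule reg)
    show "continuous_on {0..1} \<gamma>'"
      unfolding \<gamma>'_def[abs_def] by (intro continuous_intros)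
    show "\<gamma> 0 = \<gamma> 1" by (simp add: \<gamma>_def)
    fix t :: real
    show "(\<gamma> has_vector_derivative \<gamma>' t) (at t within {0..1})" by (rule deriv)
    show "\<gamma> t \<in> frontier (energy_sublevel V E)" by (rule front)
    show "\<gamma>' t \<noteq> 0" using nonzero[of t] \<open>a > 0\<close> \<open>b > 0\<close> by (simp add: velocity)
    obtain \<mu> where "\<mu> > 0" and \<mu>: "g (\<gamma> t) = \<mu> *\<^sub>R (fst (\<gamma> t), (2 * M) *\<^sub>R snd (\<gamma> t))"
      using touching_gradient[OF reg max \<open>E > 0\<close> q0(2) front[of t]] level[of t]
      by (auto simp: M_def)
    have ham: "hamiltonian_vector (g (\<gamma> t))
        = \<mu> *\<^sub>R hamiltonian_vector (fst (\<gamma> t), (2 * M) *\<^sub>R snd (\<gamma> t))"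
      by (simp add: \<mu> hamiltonian_vector_def)
    then have "\<gamma>' t = (2 * pi * b / a / \<mu>) *\<^sub>R hamiltonian_vector (g (\<gamma> t))"
      using \<open>\<mu> > 0\<close> by (simp add: velocity)
    then show "\<gamma>' t \<in> characteristic_kernel (g (\<gamma> t))"
      by (metis hamiltonian_vector_in_characteristic_kernel)
    show "\<gamma>' t \<bullet> hamiltonian_vector (g (\<gamma> t)) > 0"
      using nonzero[of t] \<open>\<mu> > 0\<close> \<open>a > 0\<close> \<open>b > 0\<close> unfolding ham velocity by simp
  qed
  moreover have "action \<gamma> = pi * E * sqrt (2 / M)"
  proof -
    have "action \<gamma> = integral {0..1} (\<lambda>t. fst (\<gamma> t) \<bullet> snd (\<gamma>' t))"
      by (rule action_eq[OF deriv])
    also have "\<dots> = integral {0..1} (\<lambda>t. (2 * pi * a * b) * (cos (2 * pi * t))\<^sup>2)"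
      by (simp add: \<gamma>_def \<gamma>'_def nq power2_eq_square mult_ac)
    also have "\<dots> = pi * (a * b)"
      using integral_unique[OF has_integral_mult_right[OF integral_cos_squared_2pi, of "2 * pi * a * b"]]
      by (simp only:)
    also have "a * b = E * sqrt (2 / M)"
      unfolding a_def b_def by (rule sqrt_semiaxes_product[OF \<open>E > 0\<close>])
    finally show ?thesis by simp
  qed
  ultimately show ?thesis unfolding M_def by blast
qed

lemma energy_sublevel_shrink_momentum:
  assumes "(p, q) \<in> energy_sublevel V E" "0 \<le> s" "s \<le> 1"
  shows "(s *\<^sub>R p, q) \<in> energy_sublevel V E"
proof -
  have "(norm (s *\<^sub>R p))\<^sup>2 \<le> (norm p)\<^sup>2"
    using assms by (intro power_mono) (auto intro: mult_left_le_one_le)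
  then show ?thesis using assms(1) unfolding energy_sublevel_def mem_Collect_eq fst_conv snd_conv
    by linarith
qed

text \<open>
  The lower bound 0 serves twice: it makes the infimum meaningful as a real number, and it allows
  the upper bound to be raised to the power \<open>n\<close>.
\<close>

lemma min_action_bounds:
  fixes V :: "real^'n::finite \<Rightarrow> real"
  assumes hom: "even_2_homogeneous V" and "E > 0" and smooth: "smooth_boundary (energy_sublevel V E)"
    and q0: "norm q0 = 1" "V q0 > 0" and max: "\<And>q. V q \<le> V q0 * (norm q)\<^sup>2"
  shows "0 \<le> min_action (energy_sublevel V E)"
    and "min_action (energy_sublevel V E) \<le> pi * E * sqrt (2 / V q0)"
proof -
  let ?A = "{action \<gamma> | \<gamma>. closed_characteristic (energy_sublevel V E) \<gamma>}"
  have nonneg: "0 \<le> x" if "x \<in> ?A" for x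
    using that action_nonneg energy_sublevel_shrink_momentum by blast
  have "pi * E * sqrt (2 / V q0) \<in> ?A"
    using smooth planar_orbit[OF hom \<open>E > 0\<close> _ q0 max] by (force simp: smooth_boundary_def)
  then show "0 \<le> min_action (energy_sublevel V E)"
    and "min_action (energy_sublevel V E) \<le> pi * E * sqrt (2 / V q0)"
    unfolding min_action_def using nonneg
    by (auto intro!: cInf_greatest cInf_lower bdd_belowI[of _ 0])
qed

section \<open>Volume and smoothness of mechanical sublevel sets\<close>

text \<open>
  The ellipsoid is the image of the unit ball under the diagonal map \<open>T (x, y) = (a x, b y)\<close>.
\<close>

lemma measure_ellipsoid_prod:
  fixes a b :: real
  assumes "a > 0" "b > 0"
  defines "Y \<equiv> {z :: 'a::euclidean_space \<times> 'b::euclidean_space. (norm (fst z) / a)\<^sup>2 + (norm (snd z) / b)\<^sup>2 \<le> 1}"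
  shows "measure lborel Y = unit_ball_vol (real (DIM('a) + DIM('b))) * (a ^ DIM('a) * b ^ DIM('b))"
proof -
  \<comment> \<open>The basis vectors of the first factor are those with vanishing second component.\<close>
  define c :: "'a \<times> 'b \<Rightarrow> real" where "c j = (if snd j = 0 then a else b)" for j
  define T :: "'a \<times> 'b \<Rightarrow> 'a \<times> 'b" where "T x = 0 + (\<Sum>j\<in>Basis. (c j * (x \<bullet> j)) *\<^sub>R j)" for x
  let ?L = "(\<lambda>u. (u, 0)) ` Basis :: ('a \<times> 'b) set" and ?R = "(\<lambda>v. (0, v)) ` Basis :: ('a \<times> 'b) set"
  have disj: "?L \<inter> ?R = {}" by (auto simp: nonzero_Basis)
  have inj: "inj_on (\<lambda>u::'a. (u, 0::'b)) Basis" "inj_on (\<lambda>v::'b. (0::'a, v)) Basis"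
    by (auto simp: inj_on_def)
  have T: "T x = (a *\<^sub>R fst x, b *\<^sub>R snd x)" for x
  proof -
    have "T x = (\<Sum>j\<in>?L. (c j * (x \<bullet> j)) *\<^sub>R j) + (\<Sum>j\<in>?R. (c j * (x \<bullet> j)) *\<^sub>R j)"
      unfolding T_def Basis_prod_def by (simp add: sum.union_disjoint disj)
    also have "\<dots> = (\<Sum>u\<in>Basis. (a * (fst x \<bullet> u)) *\<^sub>R (u, 0)) + (\<Sum>v\<in>Basis. (b * (snd x \<bullet> v)) *\<^sub>R (0, v))"
      by (cases x) (simp add: sum.reindex inj c_def nonzero_Basis cong: sum.cong)
    also have "\<dots> = (a *\<^sub>R fst x, b *\<^sub>R snd x)"
      by (simp add: sum_prod scaleR_sum_right[symmetric] euclidean_representation flip: scaleR_scaleR)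
    finally show ?thesis .
  qed
  have prod_c: "(\<Prod>j\<in>Basis. \<bar>c j\<bar>) = a ^ DIM('a) * b ^ DIM('b)"
    unfolding Basis_prod_def using assms(1,2)
    by (simp add: prod.union_disjoint disj prod.reindex inj c_def nonzero_Basis cong: prod.cong)
  have "closed Y" unfolding Y_def using assms(1,2)
    by (intro closed_Collect_le continuous_intros) auto
  then have Y: "Y \<in> sets borel" by simp
  have Tm: "T \<in> borel \<rightarrow>\<^sub>M borel" by (simp add: T_def[abs_def])
  have "T -` Y = cball 0 1"
    using assms(1,2) by (auto simp: T Y_def dist_norm norm_prod_def)
  have "lborel = density (distr lborel borel T) (\<lambda>_. (\<Prod>j\<in>Basis. \<bar>c j\<bar>))"
    unfolding T_def using assms(1,2) by (intro lborel_affine_euclidean) (simp add: c_def)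
  then have "emeasure lborel Y = emeasure (density (distr lborel borel T) (\<lambda>_. (\<Prod>j\<in>Basis. \<bar>c j\<bar>))) Y"
    by simp
  also have "\<dots> = ennreal (a ^ DIM('a) * b ^ DIM('b)) * emeasure lborel (T -` Y)"
    using Y Tm by (simp add: emeasure_density prod_c nn_integral_cmult_indicator emeasure_distr)
  finally have "measure lborel Y = (a ^ DIM('a) * b ^ DIM('b)) * measure lborel (T -` Y)"
    using assms(1,2) by (simp add: measure_def enn2real_mult)
  also have "measure lborel (T -` Y) = unit_ball_vol (real (DIM('a) + DIM('b)))"
    using content_cball[of 1 "0 :: 'a \<times> 'b"] by (simp add: \<open>T -` Y = cball 0 1\<close>)
  finally show ?thesis by (simp add: mult.commute)
qed

lemma continuous_energy:
  fixes V :: "real^'n::finite \<Rightarrow> real"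
  assumes "continuous_on UNIV V"
  shows "continuous_on UNIV (\<lambda>z. (norm (fst z))\<^sup>2 / 2 + V (snd z))"
  by (intro continuous_intros continuous_on_compose2[OF assms]) auto

lemma compact_energy_sublevel:
  fixes V :: "real^'n::finite \<Rightarrow> real"
  assumes cont: "continuous_on UNIV V" and proper: "proper_potential V" and nonneg: "\<And>q. V q \<ge> 0"
  shows "compact (energy_sublevel V E)"
proof -
  have "\<forall>\<^sub>F q in at_infinity. V q > E"
    using proper by (auto simp: proper_potential_def filterlim_at_top_dense)
  then obtain R where R: "\<And>q. norm q \<ge> R \<Longrightarrow> V q > E" by (auto simp: eventually_at_infinity)
  have "norm z \<le> sqrt (2 * E) + R" if z: "z \<in> energy_sublevel V E" for z
  proof -
    have "norm (snd z) \<le> R"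
    proof (rule ccontr)
      assume "\<not> norm (snd z) \<le> R"
      then have "V (snd z) > E" by (intro R) simp
      then show False using z zero_le_power2[of "norm (fst z)"] unfolding energy_sublevel_def mem_Collect_eq by linarith
    qed
    moreover have "(norm (fst z))\<^sup>2 \<le> 2 * E" using z nonneg[of "snd z"] by (simp add: energy_sublevel_def)
    then have "norm (fst z) \<le> sqrt (2 * E)" by (rule real_le_rsqrt)
    ultimately show ?thesis using norm_Pair_le[of "fst z" "snd z"] by simp
  qed
  then have "bounded (energy_sublevel V E)" unfolding bounded_iff by blast
  moreover have "closed (energy_sublevel V E)"
    unfolding energy_sublevel_def using continuous_energy[OF cont] by (intro closed_Collect_le) auto
  ultimately show ?thesis by (simp add: compact_eq_bounded_closed)
qed

lemma measure_energy_sublevel_ge: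
  fixes V :: "real^'n::finite \<Rightarrow> real"
  assumes cpt: "compact (energy_sublevel V E)" and "E > 0" "M > 0"
    and bound: "\<And>q. V q \<le> M * (norm q)\<^sup>2"
  shows "measure lebesgue (energy_sublevel V E) \<ge> (pi * E * sqrt (2 / M)) ^ CARD('n) / fact CARD('n)"
proof -
  define a where "a = sqrt (2 * E)"
  define b where "b = sqrt (E / M)"
  have ab: "a > 0" "b > 0" using \<open>E > 0\<close> \<open>M > 0\<close> by (auto simp: a_def b_def)
  have a2: "a\<^sup>2 = 2 * E" and b2: "b\<^sup>2 = E / M" using \<open>E > 0\<close> \<open>M > 0\<close> by (auto simp: a_def b_def)
  let ?Y = "{z :: 'n phase. (norm (fst z) / a)\<^sup>2 + (norm (snd z) / b)\<^sup>2 \<le> 1}"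
  have sub: "?Y \<subseteq> energy_sublevel V E"
  proof
    fix z :: "'n phase" assume "z \<in> ?Y"
    then have "(norm (fst z))\<^sup>2 / (2 * E) + (norm (snd z))\<^sup>2 / (E / M) \<le> 1"
      by (simp add: power_divide a2 b2)
    then have "E * ((norm (fst z))\<^sup>2 / (2 * E) + (norm (snd z))\<^sup>2 / (E / M)) \<le> E * 1"
      using \<open>E > 0\<close> by (intro mult_left_mono) auto
    then have "(norm (fst z))\<^sup>2 / 2 + M * (norm (snd z))\<^sup>2 \<le> E"
      using \<open>E > 0\<close> by (simp add: distrib_left mult.commute)
    then show "z \<in> energy_sublevel V E" using bound[of "snd z"] by (simp add: energy_sublevel_def)
  qed
  have ab_eq: "a * b = E * sqrt (2 / M)"
    unfolding a_def b_def by (rule sqrt_semiaxes_product[OF \<open>E > 0\<close>])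
  have "closed ?Y" using ab by (intro closed_Collect_le continuous_intros) auto
  \<comment> \<open>The unit ball of dimension \<open>2n\<close> has volume \<open>\<pi>\<^sup>n / n!\<close>, and the dilations have Jacobian \<open>(a b)\<^sup>n\<close>.\<close>
  have "(pi * E * sqrt (2 / M)) ^ CARD('n) / fact CARD('n)
      = unit_ball_vol (real (2 * CARD('n))) * (a ^ CARD('n) * b ^ CARD('n))"
  proof -
    have "(pi * E * sqrt (2 / M)) ^ CARD('n) = pi ^ CARD('n) * (a ^ CARD('n) * b ^ CARD('n))"
      by (simp only: ab_eq mult.assoc flip: power_mult_distrib)
    then show ?thesis unfolding unit_ball_vol_even by simp
  qed
  also have "\<dots> = measure lborel ?Y"
    using measure_ellipsoid_prod[OF ab, where 'a="real^'n" and 'b="real^'n"]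
    unfolding mult_2 by simp
  also have "\<dots> = measure lebesgue ?Y"
    using \<open>closed ?Y\<close> by (subst measure_completion) auto
  also have "\<dots> \<le> measure lebesgue (energy_sublevel V E)"
    using \<open>closed ?Y\<close> cpt sub by (intro measure_mono_fmeasurable lmeasurable_compact) auto
  finally show ?thesis .
qed

text \<open>
  On the ray through \<open>q\<close> the potential is \<open>t\<^sup>2 V q\<close>, which is positive for large \<open>t\<close> by properness.
\<close>

lemma proper_potential_pos:
  fixes V :: "'a::real_normed_vector \<Rightarrow> real"
  assumes proper: "proper_potential V" and hom: "even_2_homogeneous V" and "q \<noteq> 0"
  shows "V q > 0"
proof -
  obtain R where R: "\<And>x. norm x \<ge> R \<Longrightarrow> V x > 0"
    using proper by (auto simp: proper_potential_def filterlim_at_top_dense eventually_at_infinity)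
  have "norm ((\<bar>R\<bar> / norm q) *\<^sub>R q) \<ge> R" using \<open>q \<noteq> 0\<close> by simp
  then have "(\<bar>R\<bar> / norm q)\<^sup>2 * V q > 0" using R even_2_homogeneousD[OF hom] by metis
  then show ?thesis by (simp add: zero_less_mult_iff)
qed

lemma proper_potential_nonneg:
  fixes V :: "'a::real_normed_vector \<Rightarrow> real"
  assumes "proper_potential V" and "even_2_homogeneous V"
  shows "V q \<ge> 0"
  using proper_potential_pos[OF assms, of q] even_2_homogeneous_zero[OF assms(2)]
  by (cases "q = 0") auto

lemma max_on_sphere:
  fixes V :: "real^'n::finite \<Rightarrow> real"
  assumes cont: "continuous_on UNIV V" and hom: "even_2_homogeneous V"
  obtains q0 where "norm q0 = 1" "\<And>q. V q \<le> V q0 * (norm q)\<^sup>2"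
proof -
  obtain e :: "real^'n" where "norm e = 1" using vector_choose_size[of 1] by auto
  then have "sphere (0::real^'n) 1 \<noteq> {}" by (auto intro!: exI[of _ e])
  then obtain q0 where q0: "q0 \<in> sphere 0 1" "\<And>q. q \<in> sphere 0 1 \<Longrightarrow> V q \<le> V q0"
    using continuous_attains_sup[OF compact_sphere _ continuous_on_subset[OF cont subset_UNIV]] by metis
  have "V q \<le> V q0 * (norm q)\<^sup>2" for q
  proof (cases "q = 0")
    case False
    have "V q = (norm q)\<^sup>2 * V (q /\<^sub>R norm q)"
      using even_2_homogeneousD[OF hom, of "norm q" "q /\<^sub>R norm q"] False by simp
    moreover have "V (q /\<^sub>R norm q) \<le> V q0" using False by (intro q0) simp
    ultimately show ?thesis
      using mult_left_mono[of "V (q /\<^sub>R norm q)" "V q0" "(norm q)\<^sup>2"] by (simp add: mult.commute)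
  qed (simp add: even_2_homogeneous_zero[OF hom])
  then show ?thesis using that q0(1) by auto
qed

text \<open>
  A critical point on the energy level would have \<open>p = 0\<close>, hence \<open>V q = E > 0\<close>, and then Euler's identity
  \<open>q \<bullet> grad V q = 2 V q\<close> contradicts \<open>grad V q = 0\<close>.
\<close>

lemma smooth_boundary_energy_sublevel:
  fixes V :: "real^'n::finite \<Rightarrow> real"
  assumes "C1_function V" and hom: "even_2_homogeneous V" and pos: "\<And>q. q \<noteq> 0 \<Longrightarrow> V q > 0" and "E > 0"
  shows "smooth_boundary (energy_sublevel V E)"
proof -
  obtain G where grad: "\<And>q. GDERIV V q :> G q" and cont: "continuous_on UNIV G"
    using assms(1) by (auto simp: C1_function_def C1_with_gradient_def)
  let ?H = "\<lambda>z::'n phase. (norm (fst z))\<^sup>2 / 2 + V (snd z)"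
  let ?g = "\<lambda>z::'n phase. (fst z, G (snd z))"
  have "GDERIV ?H z :> ?g z" for z
  proof -
    have 1: "((\<lambda>z::'n phase. V (snd z)) has_derivative (\<lambda>h. snd h \<bullet> G (snd z))) (at z)"
      using grad[of "snd z"] unfolding gderiv_def
      by (rule has_derivative_compose[OF has_derivative_snd[OF has_derivative_ident]])
    have 2: "((\<lambda>z::'n phase. (norm (fst z))\<^sup>2 / 2) has_derivative (\<lambda>h. fst h \<bullet> fst z)) (at z)"
      unfolding power2_norm_eq_inner
      by (auto intro!: derivative_eq_intros simp: inner_commute)
    show ?thesis unfolding gderiv_def
      using has_derivative_add[OF 2 1] by (simp add: inner_prod_def)
  qed
  moreover have "continuous_on UNIV ?g"
    by (intro continuous_intros continuous_on_compose2[OF cont]) auto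
  moreover have "?g z \<noteq> 0" if z: "?H z = E" for z
  proof
    assume g0: "?g z = 0"
    have "- snd z \<bullet> G (snd z) < 0"
    proof -
      have "snd z \<noteq> 0" using g0 z \<open>E > 0\<close> even_2_homogeneous_zero[OF hom] by (auto simp: zero_prod_def)
      have "snd z + t *\<^sub>R snd z = (1 + t) *\<^sub>R snd z" for t :: real
        by (simp add: scaleR_left_distrib)
      then have "DERIV (\<lambda>t. (1 + t)\<^sup>2 * V (snd z)) 0 :> snd z \<bullet> G (snd z)"
        using DERIV_along_line[OF grad, of "snd z" "snd z"] by (simp add: even_2_homogeneousD[OF hom])
      moreover have "DERIV (\<lambda>t. (1 + t)\<^sup>2 * V (snd z)) 0 :> 2 * V (snd z)"
        by (auto intro!: derivative_eq_intros)
      ultimately have "snd z \<bullet> G (snd z) = 2 * V (snd z)" by (rule DERIV_unique)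
      then show ?thesis using pos[OF \<open>snd z \<noteq> 0\<close>] by simp
    qed
    then show False using g0 by (simp add: zero_prod_def)
  qed
  ultimately have "regular_sublevel ?H ?g E (energy_sublevel V E)"
    by (auto simp: regular_sublevel_def C1_with_gradient_def energy_sublevel_def)
  then show ?thesis unfolding smooth_boundary_def by blast
qed

section \<open>The Moreau envelope of a convex potential\<close>

text \<open>
  The parameter \<open>k\<close> is \<open>1 / (2 \<lambda>)\<close> in the usual normalization \<open>inf\<^sub>y V y + |q - y|\<^sup>2 / (2 \<lambda>)\<close>, so
  that the envelopes increase to \<open>V\<close> as \<open>k\<close> tends to infinity.
\<close>

definition moreau_envelope :: "real \<Rightarrow> ('a::real_normed_vector \<Rightarrow> real) \<Rightarrow> 'a \<Rightarrow> real" where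
  "moreau_envelope k V q = (INF y. V y + k * (norm (q - y))\<^sup>2)"

definition proximal_point :: "real \<Rightarrow> ('a::real_normed_vector \<Rightarrow> real) \<Rightarrow> 'a \<Rightarrow> 'a" where
  "proximal_point k V q = (SOME y. \<forall>w. V y + k * (norm (q - y))\<^sup>2 \<le> V w + k * (norm (q - w))\<^sup>2)"

lemma convex_on_power2_norm: "convex_on UNIV (\<lambda>x::'a::real_inner. (norm x)\<^sup>2)"
proof (rule convex_onI)
  fix t :: real and x y :: 'a
  assume t: "0 < t" "t < 1"
  define d where "d = y - x"
  have y: "(norm y)\<^sup>2 = (norm x)\<^sup>2 + 2 * (x \<bullet> d) + (norm d)\<^sup>2"
    using power2_norm_add_scaleR[of x 1 d] by (simp add: d_def)
  have "(1 - t) *\<^sub>R x + t *\<^sub>R y = x + t *\<^sub>R d" by (simp add: d_def algebra_simps)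
  then have "(norm ((1 - t) *\<^sub>R x + t *\<^sub>R y))\<^sup>2 = (norm x)\<^sup>2 + 2 * t * (x \<bullet> d) + t\<^sup>2 * (norm d)\<^sup>2"
    by (simp only: power2_norm_add_scaleR)
  also have "\<dots> = (1 - t) * (norm x)\<^sup>2 + t * (norm y)\<^sup>2 - t * (1 - t) * (norm d)\<^sup>2"
    unfolding y by (simp add: algebra_simps power2_eq_square[of t])
  finally show "(norm ((1 - t) *\<^sub>R x + t *\<^sub>R y))\<^sup>2 \<le> (1 - t) * (norm x)\<^sup>2 + t * (norm y)\<^sup>2"
    using t by simp
qed simp

context
  fixes V :: "'a::euclidean_space \<Rightarrow> real" and k :: real
  assumes k: "k > 0" and conv: "convex_on UNIV V" and nonneg: "\<And>q. V q \<ge> 0" and zero: "V 0 = 0"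
begin

text \<open>
  Outside the ball of radius \<open>|q|\<close> about \<open>q\<close> the quadratic term alone exceeds the value \<open>k |q|\<^sup>2\<close> taken at
  the candidate \<open>y = 0\<close>, so a minimizer over this compact ball is a global one.
\<close>

lemma proximal_point_le:
  "V (proximal_point k V q) + k * (norm (q - proximal_point k V q))\<^sup>2 \<le> V w + k * (norm (q - w))\<^sup>2"
proof -
  let ?f = "\<lambda>y. V y + k * (norm (q - y))\<^sup>2"
  have "continuous_on UNIV V" using conv by (intro convex_on_continuous) auto
  then have "continuous_on (cball q (norm q)) V" by (rule continuous_on_subset) simp
  then have "continuous_on (cball q (norm q)) ?f" by (intro continuous_intros)
  then obtain y where y: "\<And>w. w \<in> cball q (norm q) \<Longrightarrow> ?f y \<le> ?f w"
    using continuous_attains_inf[of "cball q (norm q)" ?f]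
    by (metis compact_cball centre_in_cball norm_ge_zero empty_iff)
  have "?f y \<le> ?f w" for w
  proof (cases "w \<in> cball q (norm q)")
    case False
    then have "norm q \<le> norm (q - w)" by (simp add: dist_norm)
    then have "k * (norm q)\<^sup>2 \<le> k * (norm (q - w))\<^sup>2" using k by (simp add: power_mono)
    moreover have "?f y \<le> ?f 0" by (rule y) (simp add: dist_norm)
    ultimately show ?thesis using nonneg[of w] zero by simp
  qed (rule y)
  then have "\<exists>y. \<forall>w. ?f y \<le> ?f w" by blast
  from someI_ex[OF this] show ?thesis unfolding proximal_point_def by blast
qed

lemma moreau_envelope_eq:
  "moreau_envelope k V q = V (proximal_point k V q) + k * (norm (q - proximal_point k V q))\<^sup>2"
  unfolding moreau_envelope_def using proximal_point_le by (intro cInf_eq_minimum) auto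

lemma moreau_envelope_le: "moreau_envelope k V q \<le> V w + k * (norm (q - w))\<^sup>2"
  unfolding moreau_envelope_eq by (rule proximal_point_le)

text \<open>
  First-order optimality of the proximal point \<open>p\<close>: along the segment from \<open>p\<close> to \<open>w\<close> convexity bounds
  \<open>V\<close> by its chord, and minimality gives \<open>t A - t\<^sup>2 B \<le> 0\<close> for small \<open>t > 0\<close>, hence \<open>A \<le> 0\<close>.
\<close>

lemma proximal_point_subgradient:
  "2 * k * ((q - proximal_point k V q) \<bullet> (w - proximal_point k V q)) \<le> V w - V (proximal_point k V q)"
proof -
  define p where "p = proximal_point k V q"
  define A where "A = 2 * k * ((q - p) \<bullet> (w - p)) - (V w - V p)"
  define B where "B = k * (norm (w - p))\<^sup>2"
  have "1 \<bullet> A \<le> 0"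
  proof (rule gradient_inner_nonpos[where H="\<lambda>t. t * A - t\<^sup>2 * B" and z=0 and \<delta>=1])
    show "GDERIV (\<lambda>t. t * A - t\<^sup>2 * B) 0 :> A"
      unfolding gderiv_deriv by (auto intro!: derivative_eq_intros)
    fix t :: real assume t: "0 < t" "t < 1"
    have "V p + k * (norm (q - p))\<^sup>2 \<le> V ((1 - t) *\<^sub>R p + t *\<^sub>R w) + k * (norm (q - ((1 - t) *\<^sub>R p + t *\<^sub>R w)))\<^sup>2"
      unfolding p_def by (rule proximal_point_le)
    also have "V ((1 - t) *\<^sub>R p + t *\<^sub>R w) \<le> (1 - t) * V p + t * V w"
      using convex_onD[OF conv] t by simp
    also have "q - ((1 - t) *\<^sub>R p + t *\<^sub>R w) = (q - p) + (- t) *\<^sub>R (w - p)"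
      by (simp add: algebra_simps)
    finally have "t * A - t\<^sup>2 * B \<le> 0"
      unfolding A_def B_def power2_norm_add_scaleR by (simp add: algebra_simps)
    then show "(0 + t *\<^sub>R 1) * A - (0 + t *\<^sub>R 1)\<^sup>2 * B \<le> 0 * A - 0\<^sup>2 * B" by simp
  qed simp
  then show ?thesis by (simp add: A_def p_def)
qed

text \<open>
  Add the optimality conditions at \<open>x\<close> and \<open>y\<close>, each tested with the other proximal point.
\<close>

lemma proximal_point_firmly_nonexpansive:
  "(norm (proximal_point k V x - proximal_point k V y))\<^sup>2
    \<le> (x - y) \<bullet> (proximal_point k V x - proximal_point k V y)"
proof -
  define p where "p = proximal_point k V x"
  define r where "r = proximal_point k V y"
  have "2 * k * ((x - p) \<bullet> (r - p)) + 2 * k * ((y - r) \<bullet> (p - r)) \<le> 0"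
    using proximal_point_subgradient[of x r] proximal_point_subgradient[of y p]
    by (simp add: p_def r_def)
  then have "2 * k * ((x - p) \<bullet> (r - p) + (y - r) \<bullet> (p - r)) \<le> 0" by (simp only: distrib_left)
  then have "(x - p) \<bullet> (r - p) + (y - r) \<bullet> (p - r) \<le> 0"
    using k by (simp add: mult_le_0_iff)
  then have "(norm (p - r))\<^sup>2 \<le> (x - y) \<bullet> (p - r)"
    by (simp add: power2_norm_eq_inner inner_diff_left inner_diff_right inner_commute)
  then show ?thesis by (simp add: p_def r_def)
qed

lemma proximal_point_nonexpansive:
  "norm (proximal_point k V x - proximal_point k V y) \<le> norm (x - y)"
proof -
  let ?d = "proximal_point k V x - proximal_point k V y"
  have "(norm ?d)\<^sup>2 \<le> norm (x - y) * norm ?d"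
    using proximal_point_firmly_nonexpansive[of x y] norm_cauchy_schwarz[of "x - y" ?d] by linarith
  then show ?thesis
    by (cases "norm ?d = 0") (simp_all add: power2_eq_square)
qed

text \<open>
  With \<open>P\<close> the proximal map, the gradient is \<open>2 k (q - P q)\<close>. Using \<open>P q\<close> as a candidate at \<open>q + h\<close> bounds
  the increment of the envelope from above, and using \<open>P (q + h)\<close> as a candidate at \<open>q\<close> bounds it from
  below; since \<open>P\<close> is nonexpansive, both bounds agree with the linear term up to \<open>k |h|\<^sup>2\<close>.
\<close>

lemma moreau_envelope_C1: "C1_function (moreau_envelope k V)"
proof -
  let ?P = "proximal_point k V" and ?M = "moreau_envelope k V"
  let ?g = "\<lambda>q. (2 * k) *\<^sub>R (q - ?P q)"
  have quad: "\<bar>?M (q + h) - ?M q - h \<bullet> ?g q\<bar> \<le> k * (norm h)\<^sup>2" for q h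
  proof -
    have "?M (q + h) \<le> V (?P q) + k * (norm ((q - ?P q) + 1 *\<^sub>R h))\<^sup>2"
      using moreau_envelope_le[of "q + h" "?P q"] by (simp add: algebra_simps)
    then have upper: "?M (q + h) \<le> ?M q + h \<bullet> ?g q + k * (norm h)\<^sup>2"
      unfolding power2_norm_add_scaleR moreau_envelope_eq[of q]
      by (simp add: algebra_simps inner_commute)
    have "?M q \<le> V (?P (q + h)) + k * (norm ((q + h - ?P (q + h)) + (- 1) *\<^sub>R h))\<^sup>2"
      using moreau_envelope_le[of q "?P (q + h)"] by (simp add: algebra_simps)
    then have "?M q \<le> ?M (q + h) - 2 * k * (h \<bullet> (q + h - ?P (q + h))) + k * (norm h)\<^sup>2"
      unfolding power2_norm_add_scaleR moreau_envelope_eq[of "q + h"]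
      by (simp add: algebra_simps inner_commute)
    moreover have "h \<bullet> (q + h - ?P (q + h)) \<ge> h \<bullet> (q - ?P q)"
    proof -
      have "h \<bullet> (?P (q + h) - ?P q) \<le> norm h * norm (?P (q + h) - ?P q)"
        by (rule norm_cauchy_schwarz)
      also have "\<dots> \<le> norm h * norm h"
        using proximal_point_nonexpansive[of "q + h" q] by (intro mult_left_mono) auto
      also have "\<dots> = h \<bullet> h" by (simp add: power2_norm_eq_inner flip: power2_eq_square)
      finally show ?thesis by (simp add: inner_diff_right inner_add_right)
    qed
    then have "2 * k * (h \<bullet> (q + h - ?P (q + h))) \<ge> 2 * k * (h \<bullet> (q - ?P q))"
      using k by (intro mult_left_mono) auto
    ultimately have "?M q + h \<bullet> ?g q - k * (norm h)\<^sup>2 \<le> ?M (q + h)" by simp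
    with upper show ?thesis by linarith
  qed
  have "GDERIV ?M q :> ?g q" for q
    unfolding gderiv_def
  proof (rule has_derivativeI_sandwich[of 1])
    show "bounded_linear (\<lambda>h. h \<bullet> ?g q)" by (rule bounded_linear_inner_left)
    show "((\<lambda>y. k * norm (y - q)) \<longlongrightarrow> 0) (at q)" by (auto intro!: tendsto_eq_intros)
    fix y assume "y \<noteq> q"
    then show "norm (?M y - ?M q - (y - q) \<bullet> ?g q) / norm (y - q) \<le> k * norm (y - q)"
      using quad[of q "y - q"] by (simp add: divide_le_eq power2_eq_square mult.assoc)
  qed simp
  moreover have "continuous_on UNIV ?P"
    by (rule lipschitz_on_continuous_on[of 1], rule lipschitz_onI)
      (simp_all add: dist_norm proximal_point_nonexpansive)
  then have "continuous_on UNIV ?g" by (intro continuous_intros)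
  ultimately show ?thesis
    unfolding C1_function_def C1_with_gradient_def by (intro exI[of _ ?g]) simp
qed

lemma moreau_envelope_nonneg: "moreau_envelope k V q \<ge> 0"
  unfolding moreau_envelope_eq using nonneg k by simp

lemma moreau_envelope_le_self: "moreau_envelope k V q \<le> V q"
  using moreau_envelope_le[of q q] by simp

lemma convex_on_moreau_envelope: "convex_on UNIV (moreau_envelope k V)"
proof (rule convex_onI)
  fix t :: real and x y :: 'a assume t: "0 < t" "t < 1"
  let ?p = "proximal_point k V x" and ?r = "proximal_point k V y"
  have "moreau_envelope k V ((1 - t) *\<^sub>R x + t *\<^sub>R y) \<le> V ((1 - t) *\<^sub>R ?p + t *\<^sub>R ?r)
      + k * (norm ((1 - t) *\<^sub>R x + t *\<^sub>R y - ((1 - t) *\<^sub>R ?p + t *\<^sub>R ?r)))\<^sup>2"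
    by (rule moreau_envelope_le)
  also have "(1 - t) *\<^sub>R x + t *\<^sub>R y - ((1 - t) *\<^sub>R ?p + t *\<^sub>R ?r) = (1 - t) *\<^sub>R (x - ?p) + t *\<^sub>R (y - ?r)"
    by (simp add: algebra_simps)
  also have "(norm \<dots>)\<^sup>2 \<le> (1 - t) * (norm (x - ?p))\<^sup>2 + t * (norm (y - ?r))\<^sup>2"
    using convex_onD[OF convex_on_power2_norm, of t] t by (simp del: scaleR_right_diff_distrib)
  also have "V ((1 - t) *\<^sub>R ?p + t *\<^sub>R ?r) \<le> (1 - t) * V ?p + t * V ?r"
    using convex_onD[OF conv] t by simp
  finally show "moreau_envelope k V ((1 - t) *\<^sub>R x + t *\<^sub>R y)
      \<le> (1 - t) * moreau_envelope k V x + t * moreau_envelope k V y"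
    using k unfolding moreau_envelope_eq by (simp add: algebra_simps)
qed simp

text \<open>
  Scaling the minimizer gives \<open>\<le>\<close>; the reverse inequality is the same one for the factor \<open>1 / t\<close>.
\<close>

lemma even_2_homogeneous_moreau_envelope:
  assumes hom: "even_2_homogeneous V"
  shows "even_2_homogeneous (moreau_envelope k V)"
proof -
  have le: "moreau_envelope k V (t *\<^sub>R q) \<le> t\<^sup>2 * moreau_envelope k V q" for t q
  proof -
    let ?p = "proximal_point k V q"
    have "moreau_envelope k V (t *\<^sub>R q) \<le> V (t *\<^sub>R ?p) + k * (norm (t *\<^sub>R (q - ?p)))\<^sup>2"
      using moreau_envelope_le[of "t *\<^sub>R q" "t *\<^sub>R ?p"] by (simp add: scaleR_diff_right)
    also have "\<dots> = t\<^sup>2 * moreau_envelope k V q"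
      unfolding moreau_envelope_eq even_2_homogeneousD[OF hom] norm_scaleR power_mult_distrib
      by (simp add: algebra_simps)
    finally show ?thesis .
  qed
  have "moreau_envelope k V (t *\<^sub>R q) = t\<^sup>2 * moreau_envelope k V q" for t q
  proof (cases "t = 0")
    case True
    then show ?thesis using le[of t q] moreau_envelope_nonneg[of "t *\<^sub>R q"] by simp
  next
    case False
    have "t\<^sup>2 * moreau_envelope k V q \<le> t\<^sup>2 * ((inverse t)\<^sup>2 * moreau_envelope k V (t *\<^sub>R q))"
      using le[of "inverse t" "t *\<^sub>R q"] False by (intro mult_left_mono) auto
    also have "\<dots> = moreau_envelope k V (t *\<^sub>R q)"
      using False by (simp add: power_inverse)
    finally show ?thesis using le[of t q] by simp
  qed
  then show ?thesis by (simp add: even_2_homogeneous_def)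
qed

text \<open>
  Split \<open>q\<close> as \<open>y + (q - y)\<close>. Convexity with weights \<open>1 - s\<close> and \<open>s\<close>, and homogeneity, give
  \<open>V q \<le> V y / (1 - s) + V (q - y) / s\<close>, and \<open>V (q - y) \<le> M |q - y|\<^sup>2\<close>. The weight \<open>s = M / (k + M)\<close> makes
  the ratio of the two coefficients equal to \<open>k\<close>, so that the right side is a multiple of the
  function minimized in the envelope.
\<close>

lemma moreau_envelope_ge:
  assumes hom: "even_2_homogeneous V" and M: "M > 0" and bound: "\<And>q. V q \<le> M * (norm q)\<^sup>2"
  shows "k / (k + M) * V q \<le> moreau_envelope k V q"
proof -
  define y where "y = proximal_point k V q"
  define s where "s = M / (k + M)"
  have s: "0 < s" "s < 1" "1 - s = k / (k + M)" using k M by (auto simp: s_def field_simps)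
  have "V q = V ((1 - s) *\<^sub>R (inverse (1 - s) *\<^sub>R y) + s *\<^sub>R (inverse s *\<^sub>R (q - y)))"
    using s(1,2) by simp
  also have "\<dots> \<le> (1 - s) * V (inverse (1 - s) *\<^sub>R y) + s * V (inverse s *\<^sub>R (q - y))"
    using s by (intro convex_onD[OF conv]) auto
  also have "\<dots> = inverse (1 - s) * V y + inverse s * V (q - y)"
  proof -
    have scale: "r * V (inverse r *\<^sub>R x) = inverse r * V x" if "r \<noteq> 0" for r x
      using that by (simp add: even_2_homogeneousD[OF hom] power2_eq_square)
    show ?thesis using s(1,2) by (simp only: scale)
  qed
  also have "\<dots> \<le> inverse (1 - s) * V y + inverse s * (M * (norm (q - y))\<^sup>2)"
    using s bound by simp
  finally have "(1 - s) * V q \<le> (1 - s) * (inverse (1 - s) * V y + inverse s * (M * (norm (q - y))\<^sup>2))"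
    using s by (intro mult_left_mono) auto
  also have "\<dots> = V y + ((1 - s) * inverse s * M) * (norm (q - y))\<^sup>2"
    using s(1,2) by (simp add: distrib_left mult.assoc)
  also have "(1 - s) * inverse s * M = k"
    unfolding s(3) using k M by (simp add: s_def)
  finally show ?thesis unfolding s(3) moreau_envelope_eq y_def .
qed

end

section \<open>Approximation by smooth bodies and the inequality\<close>

lemma convex_energy_sublevel:
  fixes V :: "real^'n::finite \<Rightarrow> real"
  assumes "convex_on UNIV V"
  shows "convex (energy_sublevel V E)"
proof -
  let ?H = "\<lambda>z::'n phase. (norm (fst z))\<^sup>2 / 2 + V (snd z)"
  have "convex_on UNIV ?H"
  proof (rule convex_onI)
    fix t :: real and x y :: "'n phase" assume t: "0 < t" "t < 1"
    have "(norm (fst ((1 - t) *\<^sub>R x + t *\<^sub>R y)))\<^sup>2 \<le> (1 - t) * (norm (fst x))\<^sup>2 + t * (norm (fst y))\<^sup>2"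
      using convex_onD[OF convex_on_power2_norm, of t "fst x" "fst y"] t by simp
    moreover have "V (snd ((1 - t) *\<^sub>R x + t *\<^sub>R y)) \<le> (1 - t) * V (snd x) + t * V (snd y)"
      using convex_onD[OF assms, of t "snd x" "snd y"] t by simp
    ultimately show "?H ((1 - t) *\<^sub>R x + t *\<^sub>R y) \<le> (1 - t) * ?H x + t * ?H y"
      unfolding distrib_left times_divide_eq_right by linarith
  qed simp
  note lower = convex_lower[OF this UNIV_I UNIV_I]
  show ?thesis
  proof (rule convexI)
    fix x y :: "'n phase" and u v :: real
    assume xy: "x \<in> energy_sublevel V E" "y \<in> energy_sublevel V E" and uv: "0 \<le> u" "0 \<le> v" "u + v = 1"
    have "?H (u *\<^sub>R x + v *\<^sub>R y) \<le> max (?H x) (?H y)" by (rule lower[OF uv])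
    also have "\<dots> \<le> E" using xy by (simp add: energy_sublevel_def)
    finally show "u *\<^sub>R x + v *\<^sub>R y \<in> energy_sublevel V E" by (simp add: energy_sublevel_def)
  qed
qed

lemma convex_body_energy_sublevel:
  fixes V :: "real^'n::finite \<Rightarrow> real"
  assumes conv: "convex_on UNIV V" and proper: "proper_potential V" and nonneg: "\<And>q. V q \<ge> 0"
    and zero: "V 0 = 0" and "E > 0"
  shows "convex_body (energy_sublevel V E)"
proof -
  have cont: "continuous_on UNIV V" using conv by (intro convex_on_continuous) auto
  let ?U = "{z :: 'n phase. (norm (fst z))\<^sup>2 / 2 + V (snd z) < E}"
  have "open ?U" using continuous_energy[OF cont] by (intro open_Collect_less) auto
  then have "?U \<subseteq> interior (energy_sublevel V E)"
    by (intro interior_maximal) (auto simp: energy_sublevel_def)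
  moreover have "0 \<in> ?U" using zero \<open>E > 0\<close> by simp
  ultimately have "interior (energy_sublevel V E) \<noteq> {}" by blast
  then show ?thesis
    using convex_energy_sublevel[OF conv] compact_energy_sublevel[OF cont proper nonneg]
    by (simp add: convex_body_def)
qed

text \<open>
  Of the two suprema in the Hausdorff distance, the one over the smaller set vanishes.
\<close>

lemma hausdorff_distance_superset_bounds:
  assumes "X \<subseteq> Y" "X \<noteq> {}" and d: "\<And>y. y \<in> Y \<Longrightarrow> infdist y X \<le> d"
  shows "0 \<le> hausdorff_distance Y X" "hausdorff_distance Y X \<le> d"
proof -
  have 1: "(SUP x\<in>X. infdist x Y) = 0"
  proof -
    have "(\<lambda>x. infdist x Y) ` X = {0}" using assms(1,2) by (auto simp: image_iff subset_iff)
    then show ?thesis by simp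
  qed
  have "Y \<noteq> {}" using assms(1,2) by auto
  then have 2: "(SUP y\<in>Y. infdist y X) \<le> d" using d by (intro cSUP_least)
  obtain x where "x \<in> X" using \<open>X \<noteq> {}\<close> by auto
  then have "0 \<le> d" using d[of x] assms(1) infdist_nonneg[of x X] by force
  then show "0 \<le> hausdorff_distance Y X" "hausdorff_distance Y X \<le> d"
    using 1 2 by (simp_all add: hausdorff_distance_def)
qed

lemma tendsto_ratio_to_1: "(\<lambda>i. real (Suc i) / (real (Suc i) + M)) \<longlonglongrightarrow> 1"
proof -
  have "(\<lambda>i. 1 / (1 + M * (1 / real (Suc i)))) \<longlonglongrightarrow> 1 / (1 + M * 0)"
    by (intro tendsto_intros LIMSEQ_Suc[OF lim_1_over_n]) simp
  moreover have "1 / (1 + M * (1 / real (Suc i))) = real (Suc i) / (real (Suc i) + M)" for i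
    by (simp add: divide_simps del: of_nat_Suc)
  ultimately show ?thesis by simp
qed

text \<open>
  Write \<open>X\<close> for the body and \<open>Y\<^sub>i\<close> for its approximations. Since \<open>s\<^sub>i V \<le> V\<^sub>i \<le> V\<close> with \<open>s\<^sub>i\<close> tending to 1,
  homogeneity yields the inclusions \<open>sqrt s\<^sub>i Y\<^sub>i \<subseteq> X \<subseteq> Y\<^sub>i\<close>, and \<open>X\<close> is bounded.
\<close>

lemma smooth_approximation_near:
  fixes V :: "real^'n::finite \<Rightarrow> real"
  assumes conv: "convex_on UNIV V" and proper: "proper_potential V" and hom: "even_2_homogeneous V"
    and "E > 0" and M: "M > 0" and bound: "\<And>q. V q \<le> M * (norm q)\<^sup>2"
  shows "filterlim (\<lambda>i. energy_sublevel (moreau_envelope (real (Suc i)) V) E)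
    (smooth_bodies_near (energy_sublevel V E)) sequentially"
    and "smooth_boundary (energy_sublevel (moreau_envelope (real (Suc i)) V) E)"
proof -
  let ?X = "energy_sublevel V E" and ?V = "\<lambda>i. moreau_envelope (real (Suc i)) V"
  let ?Y = "\<lambda>i. energy_sublevel (?V i) E"
  define s where "s i = real (Suc i) / (real (Suc i) + M)" for i
  have s: "0 < s i" "s i \<le> 1" for i using M by (auto simp: s_def)
  have zero: "V 0 = 0" by (rule even_2_homogeneous_zero[OF hom])
  note nonneg = proper_potential_nonneg[OF proper hom]
  have cont: "continuous_on UNIV V" using conv by (intro convex_on_continuous) auto
  have k: "real (Suc i) > 0" for i by simp
  note env = k conv nonneg zero
  have hom_env: "even_2_homogeneous (?V i)" for i
    by (rule even_2_homogeneous_moreau_envelope[OF env hom])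
  have lower: "s i * V q \<le> ?V i q" for i q
    unfolding s_def by (rule moreau_envelope_ge[OF env hom M bound])
  have upper: "?V i q \<le> V q" for i q by (rule moreau_envelope_le_self[OF env])
  have proper_env: "proper_potential (?V i)" for i
    unfolding proper_potential_def
  proof (rule filterlim_at_top_mono)
    show "filterlim (\<lambda>q. s i * V q) at_top at_infinity"
      using s proper by (intro filterlim_tendsto_pos_mult_at_top[OF tendsto_const])
        (auto simp: proper_potential_def)
  qed (intro always_eventually allI lower)
  have pos_env: "?V i q > 0" if "q \<noteq> 0" for i q
    by (rule proper_potential_pos[OF proper_env hom_env that])
  show smooth: "smooth_boundary (?Y i)" for i
    by (rule smooth_boundary_energy_sublevel[OF moreau_envelope_C1[OF env] hom_env pos_env \<open>E > 0\<close>])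
  have body: "convex_body (?Y i)" for i
    using convex_on_moreau_envelope[OF env] proper_env moreau_envelope_nonneg[OF env]
      even_2_homogeneous_zero[OF hom_env] \<open>E > 0\<close> by (rule convex_body_energy_sublevel)
  have "bounded ?X" using compact_energy_sublevel[OF cont proper nonneg] by (rule compact_imp_bounded)
  then obtain R where R: "\<And>z. z \<in> ?X \<Longrightarrow> norm z \<le> R" by (auto simp: bounded_iff)
  have sub: "?X \<subseteq> ?Y i" for i
  proof
    fix z assume "z \<in> ?X"
    then show "z \<in> ?Y i" using upper[of i "snd z"] by (simp add: energy_sublevel_def)
  qed
  have "0 \<in> ?X" using zero \<open>E > 0\<close> by (simp add: energy_sublevel_def)
  then have ne: "?X \<noteq> {}" by auto
  \<comment> \<open>The dilation by \<open>sqrt (s i)\<close> multiplies the energy terms by \<open>s i\<close>, which moves \<open>z\<close> into \<open>X\<close>.\<close>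
  have close: "infdist z ?X \<le> (1 / sqrt (s i) - 1) * R" if z: "z \<in> ?Y i" for i z
  proof -
    define \<sigma> where "\<sigma> = sqrt (s i)"
    have \<sigma>: "\<sigma> > 0" "\<sigma> \<le> 1" "\<sigma>\<^sup>2 = s i" using s[of i] by (auto simp: \<sigma>_def)
    have "(norm (fst (\<sigma> *\<^sub>R z)))\<^sup>2 / 2 + V (snd (\<sigma> *\<^sub>R z)) = s i * (norm (fst z))\<^sup>2 / 2 + s i * V (snd z)"
      using \<sigma> by (simp add: power_mult_distrib even_2_homogeneousD[OF hom])
    also have "\<dots> \<le> (norm (fst z))\<^sup>2 / 2 + ?V i (snd z)"
      using lower[of i "snd z"] mult_right_mono[OF s(2)[of i], of "(norm (fst z))\<^sup>2"] by simp
    also have "\<dots> \<le> E" using z by (simp add: energy_sublevel_def)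
    finally have in_X: "\<sigma> *\<^sub>R z \<in> ?X" by (simp add: energy_sublevel_def)
    have "infdist z ?X \<le> dist z (\<sigma> *\<^sub>R z)" by (rule infdist_le[OF in_X])
    also have "\<dots> = norm ((1 / \<sigma> - 1) *\<^sub>R (\<sigma> *\<^sub>R z))"
      using \<sigma> by (simp add: dist_norm algebra_simps)
    also have "\<dots> = (1 / \<sigma> - 1) * norm (\<sigma> *\<^sub>R z)"
      unfolding norm_scaleR[of "1 / \<sigma> - 1"] using \<sigma> by simp
    also have "\<dots> \<le> (1 / \<sigma> - 1) * R" using R[OF in_X] \<sigma> by (intro mult_left_mono) auto
    finally show ?thesis by (simp add: \<sigma>_def)
  qed
  have "(\<lambda>i. (1 / sqrt (s i) - 1) * R) \<longlonglongrightarrow> (1 / sqrt 1 - 1) * R"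
    unfolding s_def by (intro tendsto_intros tendsto_ratio_to_1) simp
  then have lim: "(\<lambda>i. (1 / sqrt (s i) - 1) * R) \<longlonglongrightarrow> 0" by simp
  have "0 \<le> hausdorff_distance (?Y i) ?X"
    "hausdorff_distance (?Y i) ?X \<le> (1 / sqrt (s i) - 1) * R" for i
    using hausdorff_distance_superset_bounds[OF sub[of i] ne close[where i=i]] by auto
  then have "(\<lambda>i. hausdorff_distance (?Y i) ?X) \<longlonglongrightarrow> 0"
    by (intro tendsto_sandwich[OF always_eventually always_eventually tendsto_const lim] allI)
  then show "filterlim ?Y (smooth_bodies_near ?X) sequentially"
    unfolding smooth_bodies_near_def
    by (auto simp: filterlim_inf filterlim_filtercomap_iff o_def filterlim_principal smooth body
        simp del: of_nat_Suc)
qed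

text \<open>
  In the non-smooth case the capacity is the limit along the envelopes, whose maxima on the sphere
  are at least \<open>s\<^sub>i V q0\<close>. That the envelopes approach \<open>X\<close> also shows that the filter of smooth bodies near
  \<open>X\<close> is proper, so that the limit is unique.
\<close>

lemma c_EHZ_bounds:
  fixes V :: "real^'n::finite \<Rightarrow> real"
  assumes proper: "proper_potential V" and hom: "even_2_homogeneous V"
    and alt: "convex_on UNIV V \<or> C1_function V" and "E > 0"
    and q0: "norm q0 = 1" and max: "\<And>q. V q \<le> V q0 * (norm q)\<^sup>2"
  shows "0 \<le> c_EHZ (energy_sublevel V E)" "c_EHZ (energy_sublevel V E) \<le> pi * E * sqrt (2 / V q0)"
proof -
  let ?X = "energy_sublevel V E"
  have pos: "V q > 0" if "q \<noteq> 0" for q by (rule proper_potential_pos[OF proper hom that])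
  have M: "V q0 > 0" using q0 by (intro pos) auto
  have "0 \<le> c_EHZ ?X \<and> c_EHZ ?X \<le> pi * E * sqrt (2 / V q0)"
  proof (cases "smooth_boundary ?X")
    case True
    then show ?thesis using min_action_bounds[OF hom \<open>E > 0\<close> True q0 M max] by (simp add: c_EHZ_def)
  next
    case False
    then have conv: "convex_on UNIV V"
      using alt smooth_boundary_energy_sublevel[OF _ hom pos \<open>E > 0\<close>] by blast
    show ?thesis
    proof (cases "convex_body ?X \<and> (\<exists>c. (min_action \<longlongrightarrow> c) (smooth_bodies_near ?X))")
      case False
      \<comment> \<open>Here the capacity has its conventional value 0.\<close>
      then show ?thesis using \<open>\<not> smooth_boundary ?X\<close> \<open>E > 0\<close> M by (auto simp: c_EHZ_def)
    next
      case True
      then obtain c where c: "(min_action \<longlongrightarrow> c) (smooth_bodies_near ?X)" by blast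
      let ?V = "\<lambda>i. moreau_envelope (real (Suc i)) V"
      let ?Y = "\<lambda>i. energy_sublevel (?V i) E"
      define s where "s i = real (Suc i) / (real (Suc i) + V q0)" for i
      note approx = smooth_approximation_near[OF conv proper hom \<open>E > 0\<close> M max]
      have "smooth_bodies_near ?X \<noteq> bot"
      proof
        assume "smooth_bodies_near ?X = bot"
        with approx(1) show False
          by (metis filterlim_def filtermap_bot_iff le_bot sequentially_bot)
      qed
      then have "c_EHZ ?X = c"
        using \<open>\<not> smooth_boundary ?X\<close> True tendsto_Lim[OF _ c] by (simp add: c_EHZ_def)
      have lim: "(\<lambda>i. min_action (?Y i)) \<longlonglongrightarrow> c"
        by (rule filterlim_compose[OF c approx(1)])
      have bounds: "0 \<le> min_action (?Y i)" "min_action (?Y i) \<le> pi * E * sqrt (2 / (s i * V q0))" for i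
      proof -
        have zero: "V 0 = 0" by (rule even_2_homogeneous_zero[OF hom])
        note nonneg = proper_potential_nonneg[OF proper hom]
        have k: "real (Suc i) > 0" by simp
        note env = k conv nonneg zero
        have hom_env: "even_2_homogeneous (?V i)" by (rule even_2_homogeneous_moreau_envelope[OF env hom])
        have "continuous_on UNIV (?V i)"
          using convex_on_moreau_envelope[OF env] by (intro convex_on_continuous) auto
        then obtain r where r: "norm r = 1" "\<And>q. ?V i q \<le> ?V i r * (norm q)\<^sup>2"
          using max_on_sphere[OF _ hom_env] by blast
        have "s i > 0" using M by (simp add: s_def)
        \<comment> \<open>The envelope need not attain its maximum on the sphere at \<open>q0\<close>, but its value there bounds the
          maximum from below.\<close>
        have "s i * V q0 \<le> ?V i q0"
          unfolding s_def by (rule moreau_envelope_ge[OF env hom M max])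
        also have "\<dots> \<le> ?V i r" using r(2)[of q0] q0 by simp
        finally have le: "s i * V q0 \<le> ?V i r" .
        have sM: "0 < s i * V q0" using \<open>s i > 0\<close> M by simp
        then have "?V i r > 0" using le by linarith
        note bound = min_action_bounds[OF hom_env \<open>E > 0\<close> approx(2) r(1) this r(2)]
        show "0 \<le> min_action (?Y i)" by (rule bound(1))
        have "pi * E * sqrt (2 / ?V i r) \<le> pi * E * sqrt (2 / (s i * V q0))"
          using le sM \<open>E > 0\<close> by (intro mult_left_mono real_sqrt_le_mono divide_left_mono) auto
        with bound(2) show "min_action (?Y i) \<le> pi * E * sqrt (2 / (s i * V q0))"
          by (rule order_trans)
      qed
      have "(\<lambda>i. pi * E * sqrt (2 / (s i * V q0))) \<longlonglongrightarrow> pi * E * sqrt (2 / (1 * V q0))"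
        unfolding s_def using M by (intro tendsto_intros tendsto_ratio_to_1) simp
      then have "c \<le> pi * E * sqrt (2 / V q0)"
        using LIMSEQ_le[OF lim] bounds(2) by simp
      moreover have "0 \<le> c" using LIMSEQ_le_const[OF lim] bounds(1) by blast
      ultimately show ?thesis using \<open>c_EHZ ?X = c\<close> by simp
    qed
  qed
  then show "0 \<le> c_EHZ ?X" "c_EHZ ?X \<le> pi * E * sqrt (2 / V q0)" by auto
qed

theorem theorem2p1:
  fixes T V :: "real^'n::finite \<Rightarrow> real" and E :: real and X :: "'n phase set"
  assumes T_def: "\<And>p. T p = (norm p)\<^sup>2 / 2"
    and proper: "proper_potential V"
    and homogeneous: "even_2_homogeneous V"
    and convex_or_C1: "convex_on UNIV V \<or> C1_function V"
    and E_pos: "E > 0"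
    and X_def: "X = {(p, q). T p + V q \<le> E}"
  shows "measure lebesgue X \<ge> c_EHZ X ^ CARD('n) / fact CARD('n)"
proof -
  have X: "X = energy_sublevel V E" by (auto simp: X_def T_def energy_sublevel_def)
  have cont: "continuous_on UNIV V"
    using convex_or_C1 C1_with_gradient_imp_continuous convex_on_continuous[OF open_UNIV]
    unfolding C1_function_def by blast
  obtain q0 where q0: "norm q0 = 1" "\<And>q. V q \<le> V q0 * (norm q)\<^sup>2"
    using max_on_sphere[OF cont homogeneous] by blast
  note nonneg = proper_potential_nonneg[OF proper homogeneous]
  have "V q0 > 0" using q0(1) by (intro proper_potential_pos[OF proper homogeneous]) auto
  note c = c_EHZ_bounds[OF proper homogeneous convex_or_C1 E_pos q0]
  have "c_EHZ X ^ CARD('n) / fact CARD('n) \<le> (pi * E * sqrt (2 / V q0)) ^ CARD('n) / fact CARD('n)"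
    unfolding X using c by (intro divide_right_mono power_mono) auto
  also have "\<dots> \<le> measure lebesgue X"
    unfolding X using compact_energy_sublevel[OF cont proper nonneg] E_pos \<open>V q0 > 0\<close> q0(2)
    by (rule measure_energy_sublevel_ge)
  finally show ?thesis .
qed

end
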